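(* Let $q=p^h$ with $p$ prime. Let $B$ be a minimal blocking set with respect to lines in $PG(2,q)$ with $|B|=q+k$, where $k<(q+3)/2$. Suppose there is a line $L$ with $|L\cap B|=k$. Then $v_B-v_L$ is a codeword of $C(PG(2,q))^\perp$ of weight $2q+1-k$, where $v_B,v_L$ are the incidence vectors of $B$ and $L$.
   Context: $C(PG(2,q))$ is the $\mathbb{F}_p$-span of the incidence vectors of the lines of $PG(2,q)$, with coordinates indexed by points. $C^\perp$ is its dual with respect to the standard scalar product over $\mathbb{F}_p$. A blocking set with respect to lines is a point set meeting every line. It is minimal if no proper subset is a blocking set. *)

theory Defs
  imports "HOL-Computational_Algebra.Primes" "HOL-Number_Theory.Cong"
begin

type_synonym 'a vec3 = "'a \<times> 'a \<times> 'a"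

definition sc3 :: "'a::field \<Rightarrow> 'a vec3 \<Rightarrow> 'a vec3" where
  "sc3 c x = (c * fst x, c * fst (snd x), c * snd (snd x))"

definition dot3 :: "'a::field vec3 \<Rightarrow> 'a vec3 \<Rightarrow> 'a" where
  "dot3 a x = fst a * fst x + fst (snd a) * fst (snd x) + snd (snd a) * snd (snd x)"

text \<open>A point is a 1-dimensional subspace, represented by its set of nonzero vectors.\<close>
definition pg_points :: "'a::field vec3 set set" where
  "pg_points = {{sc3 c x | c. c \<noteq> 0} | x. x \<noteq> (0,0,0)}"

definition pg_lines :: "'a::field vec3 set set set" where
  "pg_lines = {{P \<in> pg_points. \<forall>x\<in>P. dot3 a x = 0} | a. a \<noteq> (0,0,0)}"

text \<open>Incidence vector of a point set S (coordinates indexed by points), integer entries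
  read modulo p.\<close>
definition incvec :: "'a::field vec3 set set \<Rightarrow> 'a vec3 set \<Rightarrow> int" where
  "incvec S P = (if P \<in> S then 1 else 0)"

text \<open>The code C(PG(2,q)) over F_p: F_p-span of the incidence vectors of lines.
  Words are functions points -> int, considered modulo p.\<close>
definition code_C :: "nat \<Rightarrow> ('a::{field,finite} vec3 set \<Rightarrow> int) set" where
  "code_C p = {v. \<exists>c :: 'a vec3 set set \<Rightarrow> int. \<forall>P\<in>pg_points.
      [v P = (\<Sum>L\<in>pg_lines. c L * incvec L P)] (mod int p)}"

definition code_dual :: "nat \<Rightarrow> ('a::{field,finite} vec3 set \<Rightarrow> int) set" where
  "code_dual p = {v. \<forall>w \<in> code_C p. [(\<Sum>P\<in>pg_points. v P * w P) = 0] (mod int p)}"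

definition weight :: "nat \<Rightarrow> ('a::{field,finite} vec3 set \<Rightarrow> int) \<Rightarrow> nat" where
  "weight p v = card {P \<in> pg_points. \<not> [v P = 0] (mod int p)}"

definition blocking_set :: "'a::field vec3 set set \<Rightarrow> bool" where
  "blocking_set B \<longleftrightarrow> B \<subseteq> pg_points \<and> (\<forall>L\<in>pg_lines. L \<inter> B \<noteq> {})"

definition minimal_blocking_set :: "'a::field vec3 set set \<Rightarrow> bool" where
  "minimal_blocking_set B \<longleftrightarrow> blocking_set B \<and> (\<forall>B'. B' \<subset> B \<longrightarrow> \<not> blocking_set B')"

end

theory Submission
  imports Defs "HOL-Computational_Algebra.Polynomial" "HOL-Library.Product_Plus"
begin

text \<open>Put \<open>U = B - L\<close>, a set of \<open>q\<close> affine points. A line through a point of \<open>L\<close> outside \<open>B\<close> meets \<open>U\<close>,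
  and the \<open>q\<close> such lines other than \<open>L\<close> partition \<open>U\<close>, so each meets it exactly once. Let \<open>Q\<close> and
  \<open>Q'\<close> be points of \<open>L\<close> in \<open>B\<close>, and use \<open>Q'\<close> as the vertical direction. The Redei polynomial
  \<open>\<Prod>\<^sub>u (X + s u + Y t u)\<close> specializes to \<open>X ^ q - X\<close> for at least \<open>q + 1 - k\<close> values of \<open>Y\<close>, and
  its coefficient at \<open>X ^ i\<close> has degree at most \<open>q - i\<close> in \<open>Y\<close>. Hence at the value \<open>Y = 0\<close> belonging to \<open>Q\<close>
  it is \<open>f = X ^ q + g\<close> with \<open>degree g < k\<close>. As \<open>f\<close> splits, it divides \<open>(X + g) * g'\<close>, whose
  degree is at most \<open>2 * k - 3 < q\<close>; so \<open>g = - X\<close>, which minimality of \<open>B\<close> excludes, or \<open>g' = 0\<close>, and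
  then all root multiplicities of \<open>f\<close>, which count the points of \<open>U\<close> on the lines through \<open>Q\<close>, are
  divisible by \<open>p\<close>. So every line but \<open>L\<close> meets \<open>B\<close> in \<open>1\<close> modulo \<open>p\<close> points, and counting along the lines
  through a point of \<open>U\<close> gives \<open>k = 1\<close> modulo \<open>p\<close>.\<close>

section \<open>Lacunary polynomials over finite fields\<close>

lemma finite_field_power_card:
  fixes x :: "'a::{field,finite}"
  shows "x ^ card (UNIV :: 'a set) = x"
proof (cases "x = 0")
  case False
  have "(\<Prod>y\<in>UNIV-{0}. x * y) = (\<Prod>y\<in>UNIV-{0}. y)"
    by (rule prod.reindex_bij_witness[of _ "\<lambda>y. y / x" "\<lambda>y. x * y"]) (use False in auto)
  then have "x ^ (card (UNIV :: 'a set) - 1) * \<Prod>(UNIV-{0}) = \<Prod>(UNIV-{0})"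
    by (simp add: prod.distrib)
  then have "x ^ (card (UNIV :: 'a set) - 1) = 1"
    by simp
  then have "x ^ (card (UNIV :: 'a set) - 1) * x = x"
    by simp
  then show ?thesis
    by (subst (asm) power_minus_mult) (simp_all add: card_gt_0_iff)
qed (simp add: card_gt_0_iff)

lemma finite_field_of_nat_card:
  "of_nat (card (UNIV :: 'a::{field,finite} set)) = (0 :: 'a)"
proof -
  have "(\<Sum>x\<in>(UNIV :: 'a set). x + 1) = (\<Sum>x\<in>UNIV. x)"
    by (rule sum.reindex_bij_witness[of _ "\<lambda>y. y - 1" "\<lambda>y. y + 1"]) auto
  then show ?thesis
    by (simp add: sum.distrib)
qed

text \<open>Intersection sizes are computed inside the field; this returns to divisibility by
  \<open>p\<close>, the field having characteristic \<open>p\<close>.\<close>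

lemma finite_field_of_nat_eq_0:
  assumes "prime p" and "card (UNIV :: 'a::{field,finite} set) = p ^ h"
    and "of_nat m = (0 :: 'a)"
  shows "p dvd m"
proof -
  have "(of_nat p :: 'a) ^ h = 0"
    using finite_field_of_nat_card[where 'a='a] assms(2) by simp
  then have "(of_nat p :: 'a) = 0"
    using power_not_zero by blast
  then have "CHAR('a) dvd p"
    by (simp add: of_nat_eq_0_iff_char_dvd)
  moreover have "CHAR('a) \<noteq> 1"
    using of_nat_CHAR[where 'a='a] by (metis of_nat_1 zero_neq_one)
  ultimately have "CHAR('a) = p"
    using assms(1) prime_nat_iff by blast
  then show ?thesis
    using assms(3) by (simp add: of_nat_eq_0_iff_char_dvd)
qed

text \<open>Both sides are monic of degree q and vanish on the whole field, so their difference has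
  degree below q but q roots.\<close>

lemma prod_linear_over_finite_field:
  "(\<Prod>c\<in>UNIV. [:c, 1:]) = monom 1 (card (UNIV :: 'a::{field,finite} set)) - monom (1 :: 'a) 1"
    (is "?W = ?V")
proof (rule poly_eqI_degree_lead_coeff[where n = "card (UNIV :: 'a set)" and A = UNIV])
  let ?q = "card (UNIV :: 'a set)"
  have "card {0, 1 :: 'a} \<le> ?q"
    by (intro card_mono) auto
  then have q: "?q \<ge> 2"
    by simp
  have deg: "degree ?W = ?q"
    by (subst degree_prod_sum_eq) auto
  have "lead_coeff ?W = 1"
    by (simp add: lead_coeff_prod)
  then show "coeff ?W ?q = coeff ?V ?q"
    using q deg by simp
  show "degree ?W \<le> ?q"
    using deg by simp
  show "degree ?V \<le> ?q"
    using q by (intro degree_diff_le) (auto intro: order.trans[OF degree_monom_le])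
  fix z :: 'a
  have "poly ?W z = 0"
    by (auto simp: poly_prod intro: exI[of _ "- z"])
  then show "poly ?W z = poly ?V z"
    by (simp add: poly_monom finite_field_power_card)
qed simp

text \<open>The Redei polynomial is a polynomial in X (outer) over polynomials in Y (inner);
  specializing Y is a ring homomorphism and so passes through the product.\<close>

lemma coeff_prod_linear_poly:
  fixes s t :: "'b \<Rightarrow> 'a::comm_ring_1"
  assumes "finite U"
  shows "poly (coeff (\<Prod>u\<in>U. [:[:s u, t u:], 1:]) i) y = coeff (\<Prod>u\<in>U. [:s u + y * t u, 1:]) i"
  using assms
proof (induction U arbitrary: i rule: finite_induct)
  case (insert u U)
  then show ?case
    by (cases i) (simp_all add: algebra_simps)
qed (cases i; simp)

text \<open>Every factor has total degree 1 in X and Y, so the total degree is at most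
  \<open>card U\<close>. Beyond \<open>card U\<close> the coefficients are zero, which fits the
  truncated subtraction.\<close>

lemma degree_coeff_prod_linear_poly:
  fixes s t :: "'b \<Rightarrow> 'a::idom"
  assumes "finite U"
  shows "degree (coeff (\<Prod>u\<in>U. [:[:s u, t u:], 1:]) i) \<le> card U - i"
  using assms
proof (induction U arbitrary: i rule: finite_induct)
  case (insert u U)
  let ?P = "\<Prod>u\<in>U. [:[:s u, t u:], 1:]"
  have degP: "degree ?P = card U"
    by (subst degree_prod_sum_eq) auto
  have *: "degree ([:s u, t u:] * coeff ?P j) \<le> Suc (card U) - j" for j
  proof (cases "j \<le> card U")
    case True
    have "degree ([:s u, t u:] * coeff ?P j) \<le> degree [:s u, t u:] + degree (coeff ?P j)"
      by (rule degree_mult_le)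
    also have "\<dots> \<le> 1 + (card U - j)"
      by (intro add_mono insert.IH) simp
    finally show ?thesis
      using True by simp
  next
    case False
    then show ?thesis
      using degP by (simp add: coeff_eq_0)
  qed
  show ?case
  proof (cases i)
    case 0
    then show ?thesis
      using insert *[of 0] by simp
  next
    case (Suc j)
    have "degree (coeff ?P j) \<le> card U - j"
      by (rule insert.IH)
    then show ?thesis
      using insert *[of i] Suc by (auto intro!: degree_add_le)
  qed
qed simp

text \<open>Each summand of the derivative lacks a single linear factor, and \<open>e\<close>,
  vanishing at its root, supplies it. Repeated roots do no harm.\<close>

lemma prod_linear_dvd_mult_pderiv:
  fixes s :: "'b \<Rightarrow> 'a::field"
  assumes "finite U" and "\<And>u. u \<in> U \<Longrightarrow> poly e (- s u) = 0"
  shows "(\<Prod>u\<in>U. [:s u, 1:]) dvd e * pderiv (\<Prod>u\<in>U. [:s u, 1:])"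
proof -
  have "(\<Prod>u\<in>U. [:s u, 1:]) dvd e * (\<Prod>v\<in>U - {u}. [:s v, 1:])" if "u \<in> U" for u
  proof -
    have "[:s u, 1:] dvd e"
      using assms(2)[OF that] poly_eq_0_iff_dvd[of e "- s u"] by simp
    moreover have "(\<Prod>u\<in>U. [:s u, 1:]) = [:s u, 1:] * (\<Prod>v\<in>U - {u}. [:s v, 1:])"
      using assms(1) that by (rule prod.remove)
    ultimately show ?thesis
      by (simp only: mult_dvd_mono dvd_refl)
  qed
  then show ?thesis
    unfolding pderiv_prod sum_distrib_left by (intro dvd_sum) (simp add: pderiv_pCons)
qed

text \<open>If X + c has multiplicity n + 1 with cofactor \<open>r\<close>, cancelling its n-th
  power from the derivative and evaluating at - c leaves (n + 1) r(- c) = 0 with r(- c)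
  nonzero.\<close>

lemma of_nat_root_count_eq_0:
  fixes s :: "'b \<Rightarrow> 'a::field"
  assumes "finite U" and "pderiv (\<Prod>u\<in>U. [:s u, 1:]) = 0"
  shows "of_nat (card {u\<in>U. s u = c}) = (0 :: 'a)"
proof (cases "card {u\<in>U. s u = c}")
  case (Suc n)
  define r where "r = (\<Prod>u\<in>{u\<in>U. s u \<noteq> c}. [:s u, 1:])"
  have "(\<Prod>u\<in>U. [:s u, 1:]) = (\<Prod>u\<in>{u\<in>U. s u = c} \<union> {u\<in>U. s u \<noteq> c}. [:s u, 1:])"
    by (rule prod.cong) auto
  also have "\<dots> = (\<Prod>u\<in>{u\<in>U. s u = c}. [:s u, 1:]) * r"
    unfolding r_def by (rule prod.union_disjoint) (use assms(1) in auto)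
  also have "(\<Prod>u\<in>{u\<in>U. s u = c}. [:s u, 1:]) = [:c, 1:] ^ Suc n"
    by (simp flip: Suc)
  finally have "pderiv ([:c, 1:] ^ Suc n * r) = 0"
    using assms(2) by simp
  then have "[:c, 1:] ^ n * (smult (of_nat (Suc n)) r + [:c, 1:] * pderiv r) = 0"
    unfolding pderiv_mult pderiv_power_Suc by (simp add: pderiv_pCons algebra_simps smult_add_left)
  then have "smult (of_nat (Suc n)) r + [:c, 1:] * pderiv r = 0"
    by (subst (asm) mult_eq_0_iff) simp
  then have "poly (smult (of_nat (Suc n)) r + [:c, 1:] * pderiv r) (- c) = 0"
    by simp
  moreover have "poly r (- c) \<noteq> 0"
    using assms(1) by (auto simp: r_def poly_prod)
  ultimately show ?thesis
    using Suc by simp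
qed simp

lemma lacunary_directions:
  fixes s t :: "'b \<Rightarrow> 'a::{field,finite}"
  defines "q \<equiv> card (UNIV :: 'a set)"
  assumes fin: "finite U" and U: "card U = q"
    and Y: "\<And>y. y \<in> Y \<Longrightarrow> bij_betw (\<lambda>u. s u + y * t u) U UNIV"
    and Yk: "q + 1 \<le> card Y + k" and k: "2 \<le> k" "2 * k < q + 3"
    and s: "\<not> bij_betw s U UNIV"
  shows "of_nat (card {u\<in>U. s u = c}) = (0 :: 'a)"
proof -
  define H where "H = (\<Prod>u\<in>U. [:[:s u, t u:], 1:])"
  define W :: "'a poly" where "W = (\<Prod>c\<in>UNIV. [:c, 1:])"
  define f where "f = (\<Prod>u\<in>U. [:s u, 1:])"
  have H_eval: "poly (coeff H i) y = coeff (\<Prod>u\<in>U. [:s u + y * t u, 1:]) i" for i y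
    unfolding H_def by (rule coeff_prod_linear_poly[OF fin])
  \<comment> \<open>For \<open>y\<close> in \<open>Y\<close> the constants s u + y t u run once
    through the field, so the product becomes \<open>W\<close>, that is X^q - X.\<close>
  have HY: "poly (coeff H i) y = coeff W i" if "y \<in> Y" for i y
    unfolding H_eval W_def by (subst prod.reindex_bij_betw[OF Y[OF that], symmetric]) simp
  have Wc: "coeff W i = 0" if "k \<le> i" "i < q" for i
    using that k unfolding W_def prod_linear_over_finite_field by (simp add: q_def)
  have fc: "coeff f i = 0" if i: "k \<le> i" "i < q" for i
  proof -
    \<comment> \<open>This coefficient has degree at most q - i \<le> q - k in Y but vanishes at the
      at least q + 1 - k elements of \<open>Y\<close>.\<close>
    have "coeff H i = 0"
    proof (rule poly_eqI_degree[where A = Y])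
      show "poly (coeff H i) y = poly 0 y" if "y \<in> Y" for y
        using HY[OF that] Wc[OF i] by simp
      have "degree (coeff H i) \<le> q - i"
        unfolding H_def U[symmetric] by (rule degree_coeff_prod_linear_poly[OF fin])
      then show "card Y > degree (coeff H i)" "card Y > degree (0 :: 'a poly)"
        using i Yk by auto
    qed
    then show ?thesis
      using H_eval[of i 0] by (simp add: f_def)
  qed
  have deg_f: "degree f = q" and lead_f: "lead_coeff f = 1"
    unfolding f_def by (subst degree_prod_sum_eq) (auto simp: U lead_coeff_prod)
  have deg_W: "degree W = q" and lead_W: "lead_coeff W = 1"
    unfolding W_def by (subst degree_prod_sum_eq) (auto simp: q_def lead_coeff_prod)
  \<comment> \<open>The leading terms cancel; the term X of \<open>W\<close> stays below the bound
    because 2 \<le> k.\<close>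
  have deg_diff: "degree (f - W) \<le> k - 1"
  proof (rule degree_le, intro allI impI)
    fix i assume "k - 1 < i"
    then show "coeff (f - W) i = 0"
      using fc[of i] Wc[of i] deg_f deg_W lead_f lead_W
      by (cases "i = q"; cases "i < q") (auto simp: coeff_eq_0)
  qed
  \<comment> \<open>The term X^q contributes nothing, as q is zero in the field.\<close>
  have deg_f': "degree (pderiv f) \<le> k - 2"
  proof (rule degree_le, intro allI impI)
    fix i assume "k - 2 < i"
    moreover have "of_nat (Suc i) * coeff f (Suc i) = 0" if "Suc i = q"
      using finite_field_of_nat_card[where 'a='a] that by (simp only: q_def) simp
    ultimately show "coeff (pderiv f) i = 0"
      using fc[of "Suc i"] deg_f
      by (cases "Suc i = q"; cases "Suc i < q") (auto simp: coeff_pderiv coeff_eq_0)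
  qed
  have "f dvd (f - W) * pderiv f"
    unfolding f_def
  proof (rule prod_linear_dvd_mult_pderiv[OF fin])
    fix u assume "u \<in> U"
    then have "poly (\<Prod>u\<in>U. [:s u, 1:]) (- s u) = 0"
      using fin by (auto simp: poly_prod)
    moreover have "poly W (- s u) = 0"
      unfolding W_def by (auto simp: poly_prod)
    ultimately show "poly ((\<Prod>u\<in>U. [:s u, 1:]) - W) (- s u) = 0"
      by simp
  qed
  \<comment> \<open>The degree is at most (k - 1) + (k - 2) = 2k - 3, and this is where 2k < q + 3
    enters.\<close>
  moreover have "degree ((f - W) * pderiv f) < degree f"
    using degree_mult_le[of "f - W" "pderiv f"] deg_diff deg_f' deg_f k by linarith
  ultimately have "(f - W) * pderiv f = 0"
    using dvd_imp_degree_le by fastforce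
  moreover have "f \<noteq> W"
  proof
    assume fW: "f = W"
    have "c \<in> s ` U" for c
    proof -
      have "poly f (- c) = 0"
        unfolding fW W_def by (auto simp: poly_prod)
      then show ?thesis
        using fin by (auto simp: f_def poly_prod)
    qed
    then have "s ` U = UNIV"
      by blast
    moreover from this have "inj_on s U"
      using U fin by (intro eq_card_imp_inj_on) (auto simp: q_def)
    ultimately show False
      using s by (simp add: bij_betw_def)
  qed
  ultimately have "pderiv f = 0"
    by simp
  then show ?thesis
    unfolding f_def by (rule of_nat_root_count_eq_0[OF fin])
qed

section \<open>Coordinates in the projective plane\<close>

definition cross3 :: "'a::field vec3 \<Rightarrow> 'a vec3 \<Rightarrow> 'a vec3" where
  "cross3 a b = (fst (snd a) * snd (snd b) - snd (snd a) * fst (snd b),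
     snd (snd a) * fst b - fst a * snd (snd b), fst a * fst (snd b) - fst (snd a) * fst b)"

definition pg_point :: "'a::field vec3 \<Rightarrow> 'a vec3 set" where
  "pg_point x = {sc3 c x | c. c \<noteq> 0}"

definition pg_line :: "'a::field vec3 \<Rightarrow> 'a vec3 set set" where
  "pg_line a = {P \<in> pg_points. \<forall>x\<in>P. dot3 a x = 0}"

lemmas vec3_simps = cross3_def dot3_def sc3_def zero_prod_def plus_prod_def

lemma dot3_add: "dot3 (a + b) x = dot3 a x + dot3 b x"
  by (simp add: vec3_simps algebra_simps)

lemma dot3_sc3_left: "dot3 (sc3 c a) x = c * dot3 a x"
  by (simp add: vec3_simps algebra_simps)

lemma dot3_sc3_right: "dot3 a (sc3 c x) = c * dot3 a x"
  by (simp add: vec3_simps algebra_simps)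

lemma dot3_zero_right [simp]: "dot3 x 0 = 0"
  by (simp add: vec3_simps)

lemma sc3_zero [simp]: "sc3 0 x = 0" "sc3 c 0 = 0"
  by (simp_all add: vec3_simps)

lemma sc3_one [simp]: "sc3 1 x = x"
  by (simp add: vec3_simps)

lemma sc3_sc3: "sc3 c (sc3 d x) = sc3 (c * d) x"
  by (simp add: vec3_simps algebra_simps)

lemma sc3_add: "sc3 c (x + y) = sc3 c x + sc3 c y"
  by (simp add: vec3_simps algebra_simps)

lemma sc3_eq_0_iff [simp]: "sc3 c x = 0 \<longleftrightarrow> c = 0 \<or> x = 0"
  by (cases x) (auto simp: vec3_simps)

lemma cross3_add_right: "cross3 a (b + d) = cross3 a b + cross3 a d"
  by (simp add: vec3_simps algebra_simps)

lemma cross3_sc3_right: "cross3 a (sc3 c b) = sc3 c (cross3 a b)"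
  by (simp add: vec3_simps algebra_simps)

lemma cross3_self [simp]: "cross3 a a = 0"
  by (simp add: vec3_simps algebra_simps)

lemma cross3_zero_right [simp]: "cross3 a 0 = 0"
  by (simp add: vec3_simps)

lemma dot3_cross3_same [simp]: "dot3 a (cross3 a b) = 0" "dot3 b (cross3 a b) = 0"
  by (simp_all add: vec3_simps algebra_simps)

lemma cross3_cross3: "cross3 a (cross3 b d) = sc3 (dot3 a d) b + sc3 (- dot3 a b) d"
  by (simp add: vec3_simps algebra_simps)

lemma dot3_cross3_swap: "dot3 b (cross3 a d) = - dot3 a (cross3 b d)"
  by (simp add: vec3_simps algebra_simps)

lemma dot3_cross3_rotate: "dot3 d (cross3 a b) = dot3 a (cross3 b d)"
  by (simp add: vec3_simps algebra_simps)

lemma dot3_nondegenerate: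
  assumes "a \<noteq> 0"
  obtains w where "dot3 a w \<noteq> 0"
proof -
  have "dot3 a (1,0,0) \<noteq> 0 \<or> dot3 a (0,1,0) \<noteq> 0 \<or> dot3 a (0,0,1) \<noteq> 0"
    using assms by (cases a) (auto simp: vec3_simps)
  then show ?thesis
    using that by blast
qed

lemma dot3_commute: "dot3 a b = dot3 b a"
  by (simp add: dot3_def mult.commute)

lemma sc3_add_sc3_uminus_eq_0_iff: "sc3 c x + sc3 (- d) z = 0 \<longleftrightarrow> sc3 c x = sc3 d z"
  by (cases x; cases z) (simp add: vec3_simps)

text \<open>Expanding the triple products with some \<open>w\<close> not orthogonal to
  \<open>a\<close> gives (w.a) b = (w.b) a, and w.a is invertible.\<close>

lemma cross3_eq_0_imp_sc3:
  assumes "cross3 a b = 0" and "a \<noteq> 0"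
  obtains c where "b = sc3 c a"
proof -
  obtain w where w: "dot3 a w \<noteq> 0"
    using dot3_nondegenerate[OF assms(2)] .
  have "sc3 (dot3 w a) b + sc3 (- dot3 w b) a = 0"
    using cross3_cross3[of w b a] cross3_cross3[of w a b] assms(1)
    by (cases a; cases b; cases w) (simp add: vec3_simps algebra_simps)
  then have eq: "sc3 (dot3 w a) b = sc3 (dot3 w b) a"
    by (simp add: sc3_add_sc3_uminus_eq_0_iff)
  have "b = sc3 (inverse (dot3 w a)) (sc3 (dot3 w a) b)"
    using w by (simp add: sc3_sc3 dot3_commute[of w])
  also have "\<dots> = sc3 (inverse (dot3 w a) * dot3 w b) a"
    unfolding eq sc3_sc3 ..
  finally have "b = sc3 (inverse (dot3 w a) * dot3 w b) a" .
  then show ?thesis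
    by (rule that)
qed

text \<open>Cramer's rule, kept free of division by the determinant.\<close>

lemma dual_basis_expansion:
  "sc3 (dot3 a (cross3 b d)) m =
     sc3 (dot3 m (cross3 b d)) a + sc3 (dot3 m (cross3 d a)) b + sc3 (dot3 m (cross3 a b)) d"
  by (simp add: vec3_simps algebra_simps)

lemma dot3_separates:
  assumes "dot3 a (cross3 b d) \<noteq> 0" and "dot3 a x = 0" "dot3 b x = 0" "dot3 d x = 0"
  shows "x = 0"
proof -
  have "sc3 (dot3 a (cross3 b d)) x =
     sc3 (dot3 a x) (cross3 b d) + sc3 (dot3 b x) (cross3 d a) + sc3 (dot3 d x) (cross3 a b)"
    by (simp add: vec3_simps algebra_simps)
  then show ?thesis
    using assms by simp
qed

section \<open>Points and lines in homogeneous coordinates\<close>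

lemma pg_pointsE:
  assumes "P \<in> pg_points"
  obtains x where "x \<noteq> 0" "P = pg_point x"
  using assms by (auto simp: pg_points_def pg_point_def zero_prod_def)

lemma pg_point_in_pg_points: "x \<noteq> 0 \<Longrightarrow> pg_point x \<in> pg_points"
  unfolding pg_points_def pg_point_def zero_prod_def by blast

lemma pg_lines_eq: "pg_lines = pg_line ` (- {0})"
  by (auto simp: pg_lines_def pg_line_def zero_prod_def)

lemma pg_line_subset: "pg_line a \<subseteq> pg_points"
  by (auto simp: pg_line_def)

lemma pg_point_self: "x \<in> pg_point x"
  unfolding pg_point_def by (rule CollectI, rule exI[of _ 1]) simp

lemma pg_point_sc3:
  assumes "c \<noteq> 0"
  shows "pg_point (sc3 c x) = pg_point x"
proof -
  have *: "pg_point (sc3 e y) \<subseteq> pg_point y" if "e \<noteq> 0" for e :: 'a and y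
  proof
    fix z assume "z \<in> pg_point (sc3 e y)"
    then obtain d where "z = sc3 (d * e) y" "d \<noteq> 0"
      unfolding pg_point_def sc3_sc3 by blast
    moreover from this have "d * e \<noteq> 0"
      using that by simp
    ultimately show "z \<in> pg_point y"
      unfolding pg_point_def by blast
  qed
  have "pg_point x \<subseteq> pg_point (sc3 c x)"
    using *[of "inverse c" "sc3 c x"] assms by (simp add: sc3_sc3)
  then show ?thesis
    using *[OF assms] by blast
qed

lemma pg_line_sc3: "c \<noteq> 0 \<Longrightarrow> pg_line (sc3 c a) = pg_line a"
  by (simp add: pg_line_def dot3_sc3_left)

lemma pg_point_in_pg_line_iff:
  "x \<noteq> 0 \<Longrightarrow> pg_point x \<in> pg_line a \<longleftrightarrow> dot3 a x = 0"
  using pg_point_self[of x] pg_point_in_pg_points[of x]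
  unfolding pg_line_def by (auto simp: pg_point_def dot3_sc3_right simp del: split_paired_All)

text \<open>By the triple product expansion, a vector orthogonal to \<open>a\<close> and
  \<open>b\<close> has zero cross product with \<open>cross3 a b\<close>, hence is proportional to
  it.\<close>

lemma pg_point_meet:
  assumes "cross3 a b \<noteq> 0" "x \<noteq> 0" "dot3 a x = 0" "dot3 b x = 0"
  shows "pg_point x = pg_point (cross3 a b)"
proof -
  have "cross3 x (cross3 a b) = 0"
    using assms by (simp add: cross3_cross3 dot3_commute[of x])
  then obtain c where c: "cross3 a b = sc3 c x"
    using cross3_eq_0_imp_sc3 assms(2) by metis
  moreover from this have "c \<noteq> 0"
    using assms(1) by auto
  ultimately show ?thesis
    by (simp add: pg_point_sc3)
qed

lemma pg_line_meet:
  assumes "cross3 a b \<noteq> 0"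
  shows "pg_line a \<inter> pg_line b = {pg_point (cross3 a b)}"
proof (intro equalityI subsetI)
  fix P assume P: "P \<in> pg_line a \<inter> pg_line b"
  then obtain x where "x \<noteq> 0" "P = pg_point x"
    using pg_line_subset by (blast elim: pg_pointsE)
  then show "P \<in> {pg_point (cross3 a b)}"
    using P pg_point_meet[OF assms] by (simp add: pg_point_in_pg_line_iff)
qed (use assms in \<open>simp add: pg_point_in_pg_line_iff\<close>)

lemma cross3_neq_0_if_pg_line_neq:
  assumes "a \<noteq> 0" "b \<noteq> 0" "pg_line a \<noteq> pg_line b"
  shows "cross3 a b \<noteq> 0"
proof
  assume "cross3 a b = 0"
  then obtain c where "b = sc3 c a"
    using assms(1) cross3_eq_0_imp_sc3 by blast
  with assms show False
    by (metis pg_line_sc3 sc3_zero(1))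
qed

text \<open>The determinant condition puts the common point of the lines \<open>b\<close> and
  \<open>d\<close> off the line \<open>a\<close>, so no line of their pencil equals
  \<open>a\<close>.\<close>

lemma cross3_pencil_neq_0:
  assumes "dot3 a (cross3 b d) \<noteq> 0"
  shows "cross3 a (b + sc3 y d) \<noteq> 0" "cross3 a d \<noteq> 0"
proof -
  have "dot3 d (cross3 a (b + sc3 y d)) = dot3 a (cross3 b d)"
    by (simp add: vec3_simps algebra_simps)
  then show "cross3 a (b + sc3 y d) \<noteq> 0"
    using assms by force
  show "cross3 a d \<noteq> 0"
    using assms dot3_cross3_swap[of b a d] by force
qed

text \<open>Projection from the common point of \<open>b\<close> and \<open>d\<close>: each line of
  the pencil cuts \<open>pg_line a\<close> in one point, with \<open>d\<close> playing the parameter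
  at infinity.\<close>

lemma pg_line_parametrization:
  assumes det: "dot3 a (cross3 b d) \<noteq> 0"
  defines "R \<equiv> \<lambda>y. pg_point (cross3 a (b + sc3 y d))"
  shows "inj R" and "pg_point (cross3 a d) \<notin> range R"
    and "pg_line a = insert (pg_point (cross3 a d)) (range R)"
proof -
  note nz = cross3_pencil_neq_0[OF det]
  have on: "pg_point (cross3 a d) \<in> pg_line d" "pg_point (cross3 a d) \<in> pg_line a"
    "R y \<in> pg_line (b + sc3 y d)" "R y \<in> pg_line a" for y
    using nz by (simp_all add: R_def pg_point_in_pg_line_iff)
  have indep: False if P: "P \<in> pg_line a" "P \<in> pg_line (b + sc3 y d)" "P \<in> pg_line d" for P y
  proof -
    obtain x where x: "x \<noteq> 0" "P = pg_point x"
      using P(1) pg_line_subset by (blast elim: pg_pointsE)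
    then have "dot3 a x = 0" "dot3 b x = 0" "dot3 d x = 0"
      using P by (simp_all add: pg_point_in_pg_line_iff dot3_add dot3_sc3_left)
    then show False
      using dot3_separates[OF det] x(1) by blast
  qed
  show "pg_point (cross3 a d) \<notin> range R"
    using indep[OF on(4) on(3)] on(1) by (metis rangeE)
  show "inj R"
  proof (rule injI, rule ccontr)
    fix y z assume yz: "R y = R z" "y \<noteq> z"
    define x where "x = cross3 a (b + sc3 y d)"
    have x: "x \<noteq> 0" "R y = pg_point x"
      using nz(1) by (simp_all add: R_def x_def)
    have "dot3 b x + y * dot3 d x = 0" "dot3 b x + z * dot3 d x = 0"
      using on(3)[of y] on(3)[of z] x yz(1)
      by (simp_all add: pg_point_in_pg_line_iff dot3_add dot3_sc3_left)
    then have "(y - z) * dot3 d x = 0"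
      by (simp add: algebra_simps add_eq_0_iff)
    then have "R y \<in> pg_line d"
      using x yz(2) by (simp add: pg_point_in_pg_line_iff)
    then show False
      using indep[OF on(4) on(3)] by blast
  qed
  show "pg_line a = insert (pg_point (cross3 a d)) (range R)"
  proof (intro equalityI subsetI)
    fix P assume P: "P \<in> pg_line a"
    then obtain x where x: "x \<noteq> 0" "P = pg_point x"
      using pg_line_subset by (blast elim: pg_pointsE)
    have ax: "dot3 a x = 0"
      using P x by (simp add: pg_point_in_pg_line_iff)
    show "P \<in> insert (pg_point (cross3 a d)) (range R)"
    proof (cases "dot3 d x = 0")
      case True
      then show ?thesis
        using pg_point_meet[OF nz(2) x(1) ax] x(2) by simp
    next
      case False
      then have "dot3 (b + sc3 (- dot3 b x / dot3 d x) d) x = 0"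
        by (simp add: dot3_add dot3_sc3_left)
      then show ?thesis
        using pg_point_meet[OF nz(1) x(1) ax] x(2) by (auto simp: R_def)
    qed
  qed (use on in auto)
qed

lemma exists_dual_basis:
  assumes "a \<noteq> 0"
  obtains b d where "dot3 a (cross3 b d) \<noteq> 0"
proof -
  obtain w where w: "dot3 a w \<noteq> 0"
    using dot3_nondegenerate[OF assms] .
  \<comment> \<open>A nonzero vector cannot be proportional to two independent unit vectors.\<close>
  have "cross3 a (1,0,0) \<noteq> 0 \<or> cross3 a (0,1,0) \<noteq> 0"
    using assms by (cases a) (auto simp: vec3_simps)
  then obtain b where b: "cross3 a b \<noteq> 0"
    by blast
  then obtain d where "dot3 (cross3 a b) d \<noteq> 0"
    using dot3_nondegenerate by blast
  then have "dot3 a (cross3 b d) \<noteq> 0"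
    by (simp add: dot3_commute dot3_cross3_rotate)
  then show ?thesis
    by (rule that)
qed

lemma card_pg_line:
  fixes a :: "'a::{field,finite} vec3"
  assumes "a \<noteq> 0"
  shows "card (pg_line a) = card (UNIV :: 'a set) + 1"
proof -
  obtain b d where "dot3 a (cross3 b d) \<noteq> 0"
    using exists_dual_basis[OF assms] .
  note param = pg_line_parametrization[OF this]
  show ?thesis
    unfolding param(3) using param(1,2) by (simp add: card_image)
qed

text \<open>An affine coordinate with \<open>pg_line a\<close> as line at infinity: the ratio does
  not depend on the chosen representative, and if \<open>cross3 a b\<close> is nonzero, the level
  sets off \<open>pg_line a\<close> are the affine parts of the lines through
  \<open>pg_point (cross3 a b)\<close>.\<close>

definition slope :: "'a::field vec3 \<Rightarrow> 'a vec3 \<Rightarrow> 'a vec3 set \<Rightarrow> 'a" where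
  "slope a b P = dot3 b (SOME x. x \<in> P) / dot3 a (SOME x. x \<in> P)"

lemma slope_pg_point: "slope a b (pg_point x) = dot3 b x / dot3 a x"
proof -
  have "(SOME y. y \<in> pg_point x) \<in> pg_point x"
    by (rule someI) (rule pg_point_self)
  then obtain c where "c \<noteq> 0" "(SOME y. y \<in> pg_point x) = sc3 c x"
    unfolding pg_point_def by blast
  then show ?thesis
    by (simp add: slope_def dot3_sc3_right)
qed

lemma slope_add: "slope a (b + d) P = slope a b P + slope a d P"
  by (simp add: slope_def dot3_add add_divide_distrib)

lemma slope_sc3: "slope a (sc3 c b) P = c * slope a b P"
  by (simp add: slope_def dot3_sc3_left)

lemma slope_self:
  assumes "P \<in> pg_points - pg_line a"
  shows "slope a a P = 1"
  using assms by (auto elim!: pg_pointsE simp: slope_pg_point pg_point_in_pg_line_iff)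

lemma in_pg_line_iff_slope:
  assumes "P \<in> pg_points - pg_line a"
  shows "P \<in> pg_line b \<longleftrightarrow> slope a b P = 0"
  using assms by (auto elim!: pg_pointsE simp: slope_pg_point pg_point_in_pg_line_iff)

lemma slope_coordinates_inj:
  assumes det: "dot3 a (cross3 b d) \<noteq> 0"
    and P: "P \<in> pg_points - pg_line a" and R: "R \<in> pg_points - pg_line a"
    and eq: "slope a b P = slope a b R" "slope a d P = slope a d R"
  shows "P = R"
proof -
  obtain x where x: "x \<noteq> 0" "P = pg_point x"
    using P by (blast elim: pg_pointsE)
  obtain z where z: "z \<noteq> 0" "R = pg_point z"
    using R by (blast elim: pg_pointsE)
  have ax: "dot3 a x \<noteq> 0" and az: "dot3 a z \<noteq> 0"
    using P R x z by (auto simp: pg_point_in_pg_line_iff)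
  \<comment> \<open>The coefficients make \<open>v\<close> orthogonal to \<open>a\<close>; the equal
    slopes then make it orthogonal to \<open>b\<close> and \<open>d\<close> too.\<close>
  define v where "v = sc3 (dot3 a z) x + sc3 (- dot3 a x) z"
  have dv: "dot3 m v = dot3 a z * dot3 m x - dot3 a x * dot3 m z" for m
    by (simp add: v_def dot3_commute[of m] dot3_add dot3_sc3_left)
  have "v = 0"
  proof (rule dot3_separates[OF det])
    show "dot3 a v = 0"
      unfolding dv by simp
    show "dot3 b v = 0" "dot3 d v = 0"
      unfolding dv using eq x z ax az by (simp_all add: slope_pg_point field_simps)
  qed
  then have "sc3 (dot3 a z) x = sc3 (dot3 a x) z"
    unfolding v_def by (simp add: sc3_add_sc3_uminus_eq_0_iff)
  then show ?thesis
    using x z ax az by (metis pg_point_sc3)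
qed

section \<open>Intersections with lines modulo the characteristic\<close>

text \<open>Here \<open>pg_line a\<close> is L, and the sizes q + k and k enter only through their
  difference; k itself reappears as \<open>card (pg_line a \<inter> B)\<close>.\<close>

locale redei_blocking_set =
  fixes a :: "'a::{field,finite} vec3" and B :: "'a vec3 set set"
  assumes a_nonzero: "a \<noteq> 0"
    and minimal: "minimal_blocking_set B"
    and card_affine: "card (B - pg_line a) = card (UNIV :: 'a set)"
begin

abbreviation U :: "'a vec3 set set" where "U \<equiv> B - pg_line a"

lemma B_subset: "B \<subseteq> pg_points"
  using minimal by (simp add: minimal_blocking_set_def blocking_set_def)

lemma meets_line: "b \<noteq> 0 \<Longrightarrow> \<exists>P. P \<in> pg_line b \<inter> B"
proof -
  assume "b \<noteq> 0"
  then have "pg_line b \<in> pg_lines"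
    by (simp add: pg_lines_eq)
  then have "pg_line b \<inter> B \<noteq> {}"
    using minimal by (simp add: minimal_blocking_set_def blocking_set_def)
  then show ?thesis
    by blast
qed

text \<open>Every line through a point of L outside \<open>B\<close> is blocked, and except for L
  itself only by \<open>U\<close>. So the slope is onto, and \<open>U\<close> has just q
  elements.\<close>

lemma bij_slope:
  assumes ab: "cross3 a b \<noteq> 0" and out: "pg_point (cross3 a b) \<notin> B"
  shows "bij_betw (slope a b) U UNIV"
proof -
  have "c \<in> slope a b ` U" for c
  proof -
    \<comment> \<open>The line on which \<open>slope a b\<close> takes the value \<open>c\<close>;
      it has the same point at infinity as \<open>b\<close>.\<close>
    define m where "m = b + sc3 (- c) a"
    have am: "cross3 a m = cross3 a b"
      by (simp add: m_def cross3_add_right cross3_sc3_right)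
    then have "m \<noteq> 0"
      using ab by auto
    then obtain P where P: "P \<in> pg_line m" "P \<in> B"
      using meets_line by blast
    have "P \<notin> pg_line a"
      using pg_line_meet[of a m] am ab out P by (metis IntI singletonD)
    then have PU: "P \<in> pg_points - pg_line a"
      using P B_subset by blast
    have "slope a m P = 0"
      using P(1) in_pg_line_iff_slope[OF PU] by simp
    then have "slope a b P = c"
      using slope_self[OF PU] by (simp add: m_def slope_add slope_sc3)
    then show ?thesis
      using P \<open>P \<notin> pg_line a\<close> by blast
  qed
  then have "slope a b ` U = UNIV"
    by blast
  moreover from this have "inj_on (slope a b) U"
    using card_affine by (intro eq_card_imp_inj_on) auto
  ultimately show ?thesis
    by (simp add: bij_betw_def)
qed

text \<open>If every line through \<open>Q\<close> other than \<open>pg_line a\<close> met \<open>U\<close>, then \<open>B - {Q}\<close> would still be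
  blocking.\<close>
lemma not_bij_slope:
  assumes ab: "cross3 a b \<noteq> 0" and Q: "pg_point (cross3 a b) \<in> B"
    and Q': "Q' \<in> B" "Q' \<in> pg_line a" "Q' \<noteq> pg_point (cross3 a b)"
  shows "\<not> bij_betw (slope a b) U UNIV"
proof
  let ?Q = "pg_point (cross3 a b)"
  assume bij: "bij_betw (slope a b) U UNIV"
  have "\<exists>P. P \<in> pg_line m \<inter> (B - {?Q})" if m: "m \<noteq> 0" for m
  proof -
    obtain R where R: "R \<in> pg_line m \<inter> B"
      using meets_line[OF m] by blast
    consider "R \<noteq> ?Q" | "pg_line m = pg_line a" | "R = ?Q" "pg_line m \<noteq> pg_line a"
      by blast
    then show ?thesis
    proof cases
      case 1
      then show ?thesis
        using R by blast
    next
      case 2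
      then show ?thesis
        using Q' by blast
    next
      case 3
      then have mQ: "dot3 m (cross3 a b) = 0"
        using R ab by (simp add: pg_point_in_pg_line_iff)
      obtain d where "dot3 (cross3 a b) d \<noteq> 0"
        using dot3_nondegenerate[OF ab] .
      then have det: "dot3 a (cross3 b d) \<noteq> 0"
        by (simp add: dot3_commute dot3_cross3_rotate)
      \<comment> \<open>The line \<open>m\<close> passes through \<open>?Q\<close>, so the third
        Cramer coefficient vanishes and \<open>m\<close> lies in the pencil of \<open>a\<close> and
        \<open>b\<close>.\<close>
      have expansion: "sc3 (dot3 a (cross3 b d)) m =
          sc3 (dot3 m (cross3 b d)) a + sc3 (dot3 m (cross3 d a)) b"
        using dual_basis_expansion[of a b d m] by (simp add: mQ)
      have "m = sc3 (inverse (dot3 a (cross3 b d))) (sc3 (dot3 a (cross3 b d)) m)"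
        using det by (simp add: sc3_sc3)
      also have "\<dots> = sc3 (inverse (dot3 a (cross3 b d)) * dot3 m (cross3 b d)) a
          + sc3 (inverse (dot3 a (cross3 b d)) * dot3 m (cross3 d a)) b"
        unfolding expansion by (simp add: sc3_sc3 sc3_add)
      finally obtain x y where xy: "m = sc3 x a + sc3 y b"
        by blast
      have y: "y \<noteq> 0"
        using xy m 3(2) pg_line_sc3[of x a] by auto
      \<comment> \<open>Off \<open>pg_line a\<close>, \<open>slope a m\<close> is x + y
        \<open>slope a b\<close>, which vanishes at this value.\<close>
      obtain P where P: "P \<in> U" "slope a b P = - x / y"
        using bij by (metis (no_types, lifting) UNIV_I bij_betw_def image_iff)
      then have Pp: "P \<in> pg_points - pg_line a"
        using B_subset by blast
      have "slope a m P = 0"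
        using y P(2) slope_self[OF Pp] by (simp add: xy slope_add slope_sc3)
      then have "P \<in> pg_line m"
        using in_pg_line_iff_slope[OF Pp] by simp
      moreover have "P \<noteq> ?Q"
        using P(1) ab by (auto simp: pg_point_in_pg_line_iff)
      ultimately show ?thesis
        using P by blast
    qed
  qed
  then have "M \<inter> (B - {?Q}) \<noteq> {}" if "M \<in> pg_lines" for M
    using that unfolding pg_lines_eq by (metis ComplD empty_iff imageE insertI1)
  then have "blocking_set (B - {?Q})"
    using B_subset by (simp add: blocking_set_def subset_iff)
  then show False
    using minimal Q by (auto simp: minimal_blocking_set_def)
qed

section \<open>Sizes of affine parts and intersections, computed in the field\<close>

lemma sum_of_slopes_bij:
  assumes "dot3 a (cross3 b d) \<noteq> 0" and "pg_point (cross3 a (b + sc3 y d)) \<notin> B"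
  shows "bij_betw (\<lambda>P. slope a b P + y * slope a d P) U UNIV"
proof -
  have "slope a (b + sc3 y d) = (\<lambda>P. slope a b P + y * slope a d P)"
    by (simp add: slope_add slope_sc3 fun_eq_iff)
  then show ?thesis
    using bij_slope[OF cross3_pencil_neq_0(1)[OF assms(1)] assms(2)] by simp
qed

lemma of_nat_card_affine_part_two_points:
  assumes ab: "cross3 a b \<noteq> 0" and Q: "pg_point (cross3 a b) \<in> B"
    and Q': "Q' \<in> B" "Q' \<in> pg_line a" "Q' \<noteq> pg_point (cross3 a b)"
    and small: "2 * card (pg_line a \<inter> B) < card (UNIV :: 'a set) + 3"
  shows "of_nat (card {P\<in>U. slope a b P = 0}) = (0 :: 'a)"
proof -
  let ?q = "card (UNIV :: 'a set)" and ?k = "card (pg_line a \<inter> B)"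
  obtain z where z: "z \<noteq> 0" "Q' = pg_point z"
    using Q'(1) B_subset by (blast elim: pg_pointsE)
  then have az: "dot3 a z = 0"
    using Q'(2) by (simp add: pg_point_in_pg_line_iff)
  then have bz: "dot3 b z \<noteq> 0"
    using pg_point_meet[OF ab z(1)] Q'(3) z(2) by blast
  obtain w where w: "dot3 a w \<noteq> 0"
    using dot3_nondegenerate[OF a_nonzero] .
  \<comment> \<open>The line joining Q' to a point off \<open>pg_line a\<close>. It puts Q' at the
    infinite parameter, while \<open>b\<close> puts Q at parameter 0.\<close>
  define d where "d = cross3 z w"
  have ad: "cross3 a d = sc3 (dot3 a w) z"
    by (simp add: d_def cross3_cross3 az)
  have det: "dot3 a (cross3 b d) \<noteq> 0"
    using dot3_cross3_swap[of b a d] w bz by (auto simp: ad dot3_sc3_right)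
  have adQ': "pg_point (cross3 a d) = Q'"
    by (simp add: ad pg_point_sc3 w z(2))
  define R where "R = (\<lambda>y. pg_point (cross3 a (b + sc3 y d)))"
  note param = pg_line_parametrization[OF det, folded R_def, unfolded adQ']
  define Y where "Y = {y. R y \<notin> B}"
  \<comment> \<open>The parameters outside \<open>Y\<close> inject into the points of L in
    \<open>B\<close> other than Q', so at most k - 1 of them exist.\<close>
  have "R ` (- Y) \<subseteq> pg_line a \<inter> B - {Q'}"
    using param(2,3) by (auto simp: Y_def)
  then have "card (R ` (- Y)) \<le> card (pg_line a \<inter> B - {Q'})"
    by (intro card_mono) auto
  also have "card (pg_line a \<inter> B - {Q'}) = ?k - 1"
    using Q' by simp
  also have "card (R ` (- Y)) = card (- Y)"
    using param(1) by (intro card_image) (auto intro: inj_on_subset)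
  also have "card (- Y) = ?q - card Y"
    by (simp add: Compl_eq_Diff_UNIV card_Diff_subset)
  finally have Yk: "?q - card Y \<le> ?k - 1" .
  have "card {pg_point (cross3 a b), Q'} \<le> ?k"
    using Q Q' ab by (intro card_mono) (auto simp: pg_point_in_pg_line_iff)
  then have k2: "2 \<le> ?k"
    using Q'(3) by (simp add: card_insert_if split: if_splits)
  show ?thesis
  proof (rule lacunary_directions[where t = "slope a d" and Y = Y and k = ?k])
    show "?q + 1 \<le> card Y + ?k"
      using Yk k2 by linarith
    show "bij_betw (\<lambda>P. slope a b P + y * slope a d P) U UNIV" if "y \<in> Y" for y
      using that sum_of_slopes_bij[OF det] by (simp add: Y_def R_def)
  qed (use card_affine k2 small not_bij_slope[OF ab Q Q'] in auto)
qed

text \<open>With a single point \<open>Q\<close> on \<open>pg_line a\<close>, a line joining two points of \<open>U\<close> must pass through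
  \<open>Q\<close>, so that \<open>U\<close> is contained in one line.\<close>
lemma of_nat_card_affine_part_one_point:
  assumes ab: "cross3 a b \<noteq> 0" and single: "pg_line a \<inter> B = {pg_point (cross3 a b)}"
  shows "of_nat (card {P\<in>U. slope a b P = 0}) = (0 :: 'a)"
proof -
  \<comment> \<open>With \<open>b\<close> as the infinite parameter, Q is the one point of
    \<open>pg_line a\<close> outside the family, so the whole family avoids
    \<open>B\<close>.\<close>
  obtain w where "dot3 (cross3 a b) w \<noteq> 0"
    using dot3_nondegenerate[OF ab] .
  then have det: "dot3 a (cross3 w b) \<noteq> 0"
    using dot3_cross3_swap[of w a b] by (simp add: dot3_commute)
  note param = pg_line_parametrization[OF det]
  have "pg_point (cross3 a (w + sc3 y b)) \<notin> B" for y
    using param(2,3) single by (metis (no_types, lifting) Int_iff insertI2 rangeI singletonD)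
  note bij = sum_of_slopes_bij[OF det this]
  have const: "slope a b P = slope a b R" if PR: "P \<in> U" "R \<in> U" for P R
  proof (rule ccontr)
    assume ne: "slope a b P \<noteq> slope a b R"
    \<comment> \<open>This parameter belongs to the line joining \<open>P\<close> and
      \<open>R\<close>: both get the same value, contrary to injectivity.\<close>
    define y where "y = - (slope a w P - slope a w R) / (slope a b P - slope a b R)"
    have "slope a w P + y * slope a b P = slope a w R + y * slope a b R"
      using ne by (simp add: y_def field_simps)
    then have "P = R"
      using bij[of y] PR by (auto simp: bij_betw_def dest: inj_onD)
    then show False
      using ne by simp
  qed
  have "{P\<in>U. slope a b P = 0} = {} \<or> {P\<in>U. slope a b P = 0} = U"
  proof (cases "\<exists>R\<in>U. slope a b R = 0")
    case True
    then obtain R where "R \<in> U" "slope a b R = 0"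
      by blast
    then have "slope a b P = 0" if "P \<in> U" for P
      using const[OF that] by simp
    then show ?thesis
      by blast
  qed blast
  then have "card {P\<in>U. slope a b P = 0} = 0 \<or> card {P\<in>U. slope a b P = 0} = card (UNIV :: 'a set)"
    unfolding card_affine[symmetric] by (elim disjE) (simp_all only: card.empty simp_thms)
  then show ?thesis
    by (elim disjE) (simp_all only: finite_field_of_nat_card of_nat_0)
qed

lemma of_nat_card_affine_part:
  assumes ab: "cross3 a b \<noteq> 0"
    and small: "2 * card (pg_line a \<inter> B) < card (UNIV :: 'a set) + 3"
  shows "of_nat (card {P\<in>U. slope a b P = 0}) =
    (if pg_point (cross3 a b) \<in> B then 0 else 1 :: 'a)"
proof (cases "pg_point (cross3 a b) \<in> B")
  case True
  have on: "pg_point (cross3 a b) \<in> pg_line a"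
    using ab by (simp add: pg_point_in_pg_line_iff)
  show ?thesis
  proof (cases "pg_line a \<inter> B = {pg_point (cross3 a b)}")
    case one: True
    then show ?thesis
      using of_nat_card_affine_part_one_point[OF ab] True by simp
  next
    case False
    then obtain Q' where "Q' \<in> B" "Q' \<in> pg_line a" "Q' \<noteq> pg_point (cross3 a b)"
      using on True by blast
    then show ?thesis
      using of_nat_card_affine_part_two_points[OF ab True] small True by simp
  qed
next
  case False
  then have bij: "bij_betw (slope a b) U UNIV"
    using bij_slope[OF ab] by simp
  then obtain P where P: "P \<in> U" "slope a b P = 0"
    by (metis (no_types, lifting) UNIV_I bij_betw_def image_iff)
  have "R = P" if "R \<in> U" "slope a b R = 0" for R
    using P bij that by (metis bij_betw_imp_inj_on inj_onD)
  then have "{R\<in>U. slope a b R = 0} = {P}"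
    using P by blast
  then show ?thesis
    using False by simp
qed

text \<open>The point at infinity of the line contributes 1 exactly when the affine part contributes
  0, and conversely.\<close>

lemma of_nat_card_line_inter:
  assumes ab: "cross3 a b \<noteq> 0"
    and small: "2 * card (pg_line a \<inter> B) < card (UNIV :: 'a set) + 3"
  shows "of_nat (card (pg_line b \<inter> B)) = (1 :: 'a)"
proof -
  let ?Q = "pg_point (cross3 a b)"
  have "pg_line b \<inter> B = {P\<in>U. slope a b P = 0} \<union> ({?Q} \<inter> B)"
    using pg_line_meet[OF ab] B_subset in_pg_line_iff_slope[of _ a b] by blast
  moreover have "{P\<in>U. slope a b P = 0} \<inter> ({?Q} \<inter> B) = {}"
    using pg_line_meet[OF ab] by blast
  ultimately have "card (pg_line b \<inter> B) = card {P\<in>U. slope a b P = 0} + card ({?Q} \<inter> B)"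
    by (simp add: card_Un_disjoint)
  then show ?thesis
    using of_nat_card_affine_part[OF ab small] by simp
qed

text \<open>Double counting of the pairs of a point of \<open>U\<close> and a line through both it and a fixed
  point of \<open>U\<close>.\<close>
lemma of_nat_card_distinguished_line:
  assumes small: "2 * card (pg_line a \<inter> B) < card (UNIV :: 'a set) + 3"
  shows "of_nat (card (pg_line a \<inter> B)) = (1 :: 'a)"
proof -
  let ?q = "card (UNIV :: 'a set)" and ?k = "card (pg_line a \<inter> B)"
  obtain b d where det: "dot3 a (cross3 b d) \<noteq> 0"
    using exists_dual_basis[OF a_nonzero] .
  define R where "R = (\<lambda>y. pg_point (cross3 a (b + sc3 y d)))"
  define Q where "Q = pg_point (cross3 a d)"
  note nz = cross3_pencil_neq_0[OF det]
  note param = pg_line_parametrization[OF det, folded R_def Q_def]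
  have "U \<noteq> {}"
    using card_affine finite_UNIV_card_ge_0[where 'a='a] by force
  then obtain P0 where P0: "P0 \<in> U"
    by blast
  define s t where "s = slope a b" and "t = slope a d"
  define n where "n y = card {P\<in>U. s P + y * t P = s P0 + y * t P0}" for y
  define n' where "n' = card {P\<in>U. t P = t P0}"
  \<comment> \<open>Subtracting a multiple of \<open>a\<close> moves the level set through
    \<open>P0\<close> to level 0 without changing the point at infinity.\<close>
  have shift: "of_nat (card {P\<in>U. slope a m P = slope a m P0}) =
      (if pg_point (cross3 a m) \<in> B then 0 else 1 :: 'a)" if am: "cross3 a m \<noteq> 0" for m
  proof -
    define m' where "m' = m + sc3 (- slope a m P0) a"
    have am': "cross3 a m' = cross3 a m"
      by (simp add: m'_def cross3_add_right cross3_sc3_right)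
    have "slope a m' P = slope a m P - slope a m P0" if "P \<in> U" for P
      using slope_self[of P a] that B_subset by (auto simp: m'_def slope_add slope_sc3)
    then have "{P\<in>U. slope a m P = slope a m P0} = {P\<in>U. slope a m' P = 0}"
      by auto
    then show ?thesis
      using of_nat_card_affine_part[of m', OF _ small] am am' by simp
  qed
  have n: "of_nat (n y) = (if R y \<in> B then 0 else 1 :: 'a)" for y
    using shift[OF nz(1)] by (simp add: n_def s_def t_def R_def slope_add slope_sc3)
  have n': "of_nat n' = (if Q \<in> B then 0 else 1 :: 'a)"
    using shift[OF nz(2)] by (simp add: n'_def t_def Q_def)
  \<comment> \<open>The lines through \<open>P0\<close> other than those missed by affine
    coordinates are the q parameters \<open>y\<close> and the one for \<open>d\<close>. Another
    point lies on exactly one of them, \<open>P0\<close> on all q + 1.\<close>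
  have count: "card {y. s P + y * t P = s P0 + y * t P0} + (if t P = t P0 then 1 else 0) =
      (if P = P0 then ?q + 1 else 1)" if P: "P \<in> U" for P
  proof (cases "t P = t P0")
    case True
    have "s P = s P0 \<longleftrightarrow> P = P0"
      using slope_coordinates_inj[OF det, of P P0] P P0 B_subset True by (auto simp: s_def t_def)
    then show ?thesis
      using True by auto
  next
    case False
    have "s P + y * t P = s P0 + y * t P0 \<longleftrightarrow> y = (s P0 - s P) / (t P - t P0)" for y
      using False by (auto simp: field_simps)
    then show ?thesis
      using False by auto
  qed
  have "(\<Sum>y\<in>UNIV. n y) + n' =
      (\<Sum>P\<in>U. card {y. s P + y * t P = s P0 + y * t P0} + (if t P = t P0 then 1 else 0))"
  proof -
    have "(\<Sum>y\<in>UNIV. n y) =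
        (\<Sum>y\<in>UNIV. \<Sum>P\<in>U. if s P + y * t P = s P0 + y * t P0 then 1 else 0)"
      unfolding n_def by (simp add: sum.If_cases Int_def)
    also have "\<dots> = (\<Sum>P\<in>U. \<Sum>y\<in>UNIV. if s P + y * t P = s P0 + y * t P0 then 1 else 0)"
      by (rule sum.swap)
    also have "\<dots> = (\<Sum>P\<in>U. card {y. s P + y * t P = s P0 + y * t P0})"
      by (simp add: sum.If_cases)
    moreover have "n' = (\<Sum>P\<in>U. if t P = t P0 then 1 else 0)"
      unfolding n'_def by (simp add: sum.If_cases Int_def)
    ultimately show ?thesis
      by (simp add: sum.distrib)
  qed
  also have "\<dots> = (\<Sum>P\<in>U. if P = P0 then ?q + 1 else 1)"
    using count by (intro sum.cong) auto
  also have "\<dots> = (?q + 1) + (\<Sum>P\<in>U - {P0}. 1)"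
    using P0 by (subst sum.remove[of _ P0]) (auto intro!: sum.cong)
  also have "\<dots> = 2 * ?q"
    using P0 card_affine finite_UNIV_card_ge_0[where 'a='a] by simp
  finally have "of_nat ((\<Sum>y\<in>UNIV. n y) + n') = (of_nat (2 * ?q) :: 'a)"
    by simp
  \<comment> \<open>The total is (q + 1) + (q - 1) = 2q, zero in the field; the left side counts the
    points of L outside \<open>B\<close>.\<close>
  then have "(\<Sum>y\<in>UNIV. if R y \<in> B then 0 else 1 :: 'a) + (if Q \<in> B then 0 else 1) = 0"
    by (simp add: n n' finite_field_of_nat_card)
  moreover have "(\<Sum>y\<in>UNIV. if R y \<in> B then 0 else 1 :: 'a) = (\<Sum>P\<in>range R. if P \<in> B then 0 else 1)"
    using param(1) by (simp add: sum.reindex)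
  ultimately have "(\<Sum>P\<in>pg_line a. if P \<in> B then 0 else 1 :: 'a) = 0"
    using param(2) unfolding param(3) by (subst sum.insert) (simp_all add: add.commute)
  moreover have "(\<Sum>P\<in>pg_line a. if P \<in> B then 0 else 1 :: 'a) + of_nat ?k =
      (\<Sum>P\<in>pg_line a. (if P \<in> B then 0 else 1) + (if P \<in> B then 1 else 0))"
    unfolding sum.distrib by (simp add: sum.If_cases)
  moreover have "\<dots> = (\<Sum>P\<in>pg_line a. 1)"
    by (intro sum.cong) auto
  ultimately show ?thesis
    by (simp add: card_pg_line[OF a_nonzero] finite_field_of_nat_card)
qed

text \<open>Both sides are 1 in the field: distinct lines share one point, and L has q + 1
  points.\<close>

lemma of_nat_card_inter_eq:
  assumes "b \<noteq> 0" and small: "2 * card (pg_line a \<inter> B) < card (UNIV :: 'a set) + 3"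
  shows "of_nat (card (pg_line b \<inter> B)) = (of_nat (card (pg_line b \<inter> pg_line a)) :: 'a)"
proof (cases "pg_line a = pg_line b")
  case True
  then show ?thesis
    using of_nat_card_distinguished_line[OF small] card_pg_line[OF a_nonzero]
    by (simp add: finite_field_of_nat_card flip: True)
next
  case False
  then have ab: "cross3 a b \<noteq> 0"
    using cross3_neq_0_if_pg_line_neq a_nonzero assms(1) by blast
  then show ?thesis
    using of_nat_card_line_inter[OF ab small] pg_line_meet[OF ab] by (simp add: Int_commute)
qed

end

section \<open>Passage to the dual code and the weight\<close>

lemma cong_of_nat_eq_finite_field:
  assumes "prime p" and "card (UNIV :: 'a::{field,finite} set) = p ^ h"
    and "of_nat m = (of_nat n :: 'a)"
  shows "[int m = int n] (mod int p)"
  using assms(3)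
proof (induction m n rule: linorder_wlog)
  case (le m n)
  then have "of_nat (n - m) = (0 :: 'a)"
    by simp
  then have "p dvd n - m"
    by (rule finite_field_of_nat_eq_0[OF assms(1,2)])
  then have "int p dvd int n - int m"
    using le(1) by (metis int_dvd_int_iff of_nat_diff)
  then show ?case
    by (intro cong_sym[of "int n"]) (simp add: cong_iff_dvd_diff)
next
  case (sym m n)
  then show ?case
    by (simp add: cong_sym_eq)
qed

lemma sum_incvec:
  assumes "S \<subseteq> pg_points"
  shows "(\<Sum>P\<in>pg_points. incvec S P * incvec M P) = int (card (M \<inter> (S :: 'a::{field,finite} vec3 set set)))"
proof -
  have "incvec S P * incvec M P = (if P \<in> M \<inter> S then 1 else 0)" for P
    by (simp add: incvec_def)
  moreover have "{P \<in> pg_points. P \<in> M \<and> P \<in> S} = M \<inter> S"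
    using assms by blast
  ultimately show ?thesis
    by (simp add: sum.If_cases Int_def)
qed

text \<open>By bilinearity modulo \<open>p\<close>, orthogonality need only be tested on the
  spanning incidence vectors.\<close>

lemma in_code_dualI:
  fixes v :: "'a::{field,finite} vec3 set \<Rightarrow> int"
  assumes "\<And>M. M \<in> pg_lines \<Longrightarrow> [(\<Sum>P\<in>pg_points. v P * incvec M P) = 0] (mod int p)"
  shows "v \<in> code_dual p"
  unfolding code_dual_def
proof (intro CollectI ballI)
  fix w assume "(w :: 'a vec3 set \<Rightarrow> int) \<in> code_C p"
  then obtain c where c: "\<And>P. P \<in> pg_points \<Longrightarrow> [w P = (\<Sum>L\<in>pg_lines. c L * incvec L P)] (mod int p)"
    by (auto simp: code_C_def)
  have "[(\<Sum>P\<in>pg_points. v P * w P) = (\<Sum>P\<in>pg_points. v P * (\<Sum>L\<in>pg_lines. c L * incvec L P))] (mod int p)"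
    by (intro cong_sum cong_mult cong_refl c)
  also have "(\<Sum>P\<in>pg_points. v P * (\<Sum>L\<in>pg_lines. c L * incvec L P)) =
      (\<Sum>L\<in>pg_lines. c L * (\<Sum>P\<in>pg_points. v P * incvec L P))"
    unfolding sum_distrib_left by (subst sum.swap) (simp add: algebra_simps)
  also have "[\<dots> = (\<Sum>L\<in>pg_lines. c L * 0)] (mod int p)"
    by (intro cong_sum cong_mult cong_refl assms)
  finally show "[(\<Sum>P\<in>pg_points. v P * w P) = 0] (mod int p)"
    by simp
qed

text \<open>The entries cancel on the intersection and are 1 or - 1 on the symmetric difference,
  hence nonzero modulo \<open>p\<close>.\<close>

lemma weight_incvec_diff:
  assumes "2 \<le> p" and "S \<subseteq> pg_points" "M \<subseteq> pg_points"
  shows "weight p (\<lambda>P. incvec S P - incvec M P) = card (S - M) + card (M - S)"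
proof -
  have "\<not> [1 = 0] (mod int p)" "\<not> [- 1 = 0] (mod int p)"
    using assms(1) by (simp_all add: cong_0_iff)
  then have "{P \<in> pg_points. \<not> [incvec S P - incvec M P = 0] (mod int p)} = (S - M) \<union> (M - S)"
    using assms(2,3) by (auto simp: incvec_def split: if_splits)
  then show ?thesis
    unfolding weight_def by (simp add: card_Un_disjoint Diff_Int_distrib2)
qed

theorem mainTheorem18:
  fixes B :: "'a::{field,finite} vec3 set set"
    and L :: "'a vec3 set set"
    and p h q k :: nat
  assumes "prime p" and "q = p ^ h" and "card (UNIV :: 'a set) = q"
    and "minimal_blocking_set B"
    and "card B = q + k"
    and "2 * k < q + 3"
    and "L \<in> pg_lines"
    and "card (L \<inter> B) = k"
  shows "(\<lambda>P. incvec B P - incvec L P) \<in> code_dual p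
    \<and> weight p (\<lambda>P. incvec B P - incvec L P) = 2 * q + 1 - k"
proof
  obtain a where a: "a \<noteq> 0" "L = pg_line a"
    using assms(7) by (auto simp: pg_lines_eq)
  have BL: "card (B - L) = q"
    using card_Diff_subset_Int[of B L] assms(5,8) by (simp add: Int_commute)
  interpret redei_blocking_set a B
    using a(1) assms(3,4) BL unfolding a(2) by unfold_locales simp_all
  show "(\<lambda>P. incvec B P - incvec L P) \<in> code_dual p"
  proof (rule in_code_dualI)
    fix M :: "'a vec3 set set" assume "M \<in> pg_lines"
    then obtain b where b: "b \<noteq> 0" "M = pg_line b"
      by (auto simp: pg_lines_eq)
    have "of_nat (card (M \<inter> B)) = (of_nat (card (M \<inter> L)) :: 'a)"
      using of_nat_card_inter_eq[OF b(1)] a b assms(3,6,8) by simp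
    then have "[int (card (M \<inter> B)) = int (card (M \<inter> L))] (mod int p)"
      using cong_of_nat_eq_finite_field assms(1-3) by metis
    then show "[(\<Sum>P\<in>pg_points. (incvec B P - incvec L P) * incvec M P) = 0] (mod int p)"
      using pg_line_subset[of a]
      by (simp add: left_diff_distrib sum_subtractf sum_incvec B_subset a cong_diff_iff_cong_0)
  qed
  have "card (L - B) = q + 1 - k"
    using card_Diff_subset_Int[of L B] card_pg_line[OF a(1)] a assms(3,8) by simp
  \<comment> \<open>Guards the truncated subtraction when q and q + 1 - k are added.\<close>
  moreover have "k \<le> q + 1"
    using card_mono[of L "L \<inter> B"] card_pg_line[OF a(1)] a assms(3,8) by simp
  ultimately show "weight p (\<lambda>P. incvec B P - incvec L P) = 2 * q + 1 - k"
    using weight_incvec_diff[of p B L] prime_ge_2_nat[OF assms(1)] B_subset pg_line_subset[of a] a BL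
    by simp
qed

end
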